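(* Consider one coarse time-step, from $t^n$ to $t^{n+1}=t^n+\Delta t$, of the FB-LTS scheme (defined in the context, with an arbitrary positive integer $M$ and FB-weights $\beta_1,\beta_2,\beta_3$) applied to the TRiSK spatial discretization of the shallow water equations, and let the discrete absolute vorticity $\eta_v$ on dual cells be governed by the TRiSK absolute vorticity equation $$\partial_t\eta_v=\Theta_v(\mathbf{u},\mathbf{h})=\frac{-1}{A_v}\sum_{e\in\mathcal{E}_v}-t_{e,v}\,d_e\,\hat q_e\,F_e^\perp ,\qquad v\in\Omega_D,$$ advanced in time by FB-LTS as described in the context. Assume either that there are no boundary conditions (the domain has no boundary, so every dual cell edge is shared by exactly two dual cells) or that no-flow boundary conditions hold (the normal velocity is zero at the boundary, so there is no flux out of the domain boundary). Then FB-LTS exactly preserves the discrete representation of absolute vorticity: the globally integrated absolute vorticity is constant in time, i.e. $$\sum_{v\in\Omega_D}A_v\,\eta_v^{n+1}=\sum_{v\in\Omega_D}A_v\,\eta_v^{n}.$$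
   Context: **Equations and mesh.** The shallow water equations are $\partial_t \mathbf{u}+(\nabla\times\mathbf{u}+f\mathbf{k})\times\mathbf{u}=-\nabla\frac{|\mathbf{u}|^2}{2}-g\nabla(h+z_b)$, $\partial_t h+\nabla\cdot(h\mathbf{u})=0$ ($\mathbf u$ horizontal velocity, $h$ thickness, $f$ Coriolis parameter, $\mathbf k$ local vertical unit vector, $g$ gravitational constant, $z_b$ bottom height). Absolute vorticity is $\eta=\mathbf{k}\cdot\nabla\times\mathbf{u}+f$ and potential vorticity (PV) is $q=\eta/h$; taking the curl of the momentum equation gives $\partial_t\eta+\nabla\cdot(\eta\mathbf{u})=0$, equivalently $\partial_t(qh)+\nabla\cdot(q(h\mathbf{u}))=0$. TRiSK is a C-grid finite-volume discretization on a polygonal mesh with finite set of primal cells $\Omega_P$, set of cell edges $\Omega_E$, and dual cells $\Omega_D$ centered at the vertices of primal cells (each dual cell edge joins the centers of two adjacent primal cells and is orthogonal to the primal edge $e$ they share; dual edges are indexed by these $e$). The unknowns are $\mathbf{h}=(h_i)_{i\in\Omega_P}$ (thickness at cell centers) and $\mathbf{u}=(u_e)_{e\in\Omega_E}$ (component of velocity along a fixed unit normal $\mathbf{n}_e$ of edge $e$). The semi-discrete system is $\partial_t u_e=\Phi_e(\mathbf{u},\mathbf{h})$, $\partial_t h_i=\Psi_i(\mathbf{u},\mathbf{h})$, where $\Phi_e$ is the discretized momentum tendency and $\Psi_i(\mathbf{u},\mathbf{h})=\frac{-1}{A_i}\sum_{e\in\mathcal{E}_i}n_{e,i}\ell_eF_e(u_e,\mathbf{h})$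 with $A_i$ the area of cell $i$, $\mathcal{E}_i$ its set of edges, $\ell_e$ the length of edge $e$, $n_{e,i}\in\{1,-1\}$ such that $n_{e,i}\mathbf{n}_e$ is the outward normal to cell $i$ at $e$, and $F_e=F_e(u_e,\mathbf{h})$ the signed thickness flux at $e$ in direction $\mathbf{n}_e$. **Discrete vorticity equation.** In $\Theta_v$: $A_v$ is the area of dual cell $v$; $\mathcal{E}_v$ is the set of edges of dual cell $v$; with $\mathbf{t}_e=\mathbf{k}\times\mathbf{n}_e$ (normal to the dual edge $e$), $t_{e,v}=-1$ if $\mathbf{t}_e$ is outward and $t_{e,v}=1$ if $\mathbf{t}_e$ is inward to dual cell $v$ (so $t_{e,v}=-t_{e,v'}$ if dual edge $e$ is shared by $v\neq v'$); $d_e$ is the length of dual edge $e$; $\hat q_e$ is the value of the PV interpolated to edge $e$ (one value per edge, determined by $(\mathbf{u},\mathbf{h})$); and $F_e^\perp=\mathcal{M}_e(\mathbf{F}(\mathbf{u},\mathbf{h}))$, where $\mathbf{F}=(F_e)_{e\in\Omega_E}$ and $\mathcal{M}_e$ is the (fixed, linear) TRiSK flux mapping operator, sending the primal flux field normal to primal edges to the dual flux field tangent to primal edges, i.e. normal to dual edges (one value per edge). Thus $\hat q_eF_e^\perp$ is the absolute vorticity flux through dual edge $e$. **LTS regions.** $\Omega_P=\mathcal{F}_P\cup\mathcal{C}_P$ (fine and coarse cells, disjoint), and $\mathcal{C}_P$ is the disjoint union of $\mathcal{C}_P^{\text{IF-1}}$ (interface one), $\mathcal{C}_P^{\text{IF-2}}$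 (interface two) and $\mathcal{C}_P^{\text{int}}$ (interior coarse). In the ordering fine, IF-1, IF-2, int, only consecutive regions border each other. Edges are partitioned correspondingly into $\mathcal{F}_E,\mathcal{C}_E^{\text{IF-1}},\mathcal{C}_E^{\text{IF-2}},\mathcal{C}_E^{\text{int}}$, and dual cells into $\mathcal{F}_D,\mathcal{C}_D^{\text{IF-1}},\mathcal{C}_D^{\text{IF-2}},\mathcal{C}_D^{\text{int}}$; an edge (resp. dual cell) touching primal cells of two different regions (the cells sharing the edge, resp. the cells whose centers are the corners of the dual cell) belongs to the region closest to the fine region. With $r$ the stencil radius of the tendency operators, $\mathcal{F}_P^\ell\subseteq\mathcal{F}_P$ ($\ell=1,\dots,5$) consists of the $\ell r$ layers of fine cells neighboring $\mathcal{C}_P$, and $\mathcal{F}_E^\ell$ is the corresponding set of edges. It is assumed that there are enough layers of interface cells that the stencils of the tendencies ($\Phi_e$, $\Psi_i$, $\Theta_v$, including every flux entering them) in any region contain no cells or edges more than one region away. **FB-LTS scheme.** Given $(\mathbf{u}^n,\mathbf{h}^n)$, a step proceeds as follows (data denoted by a tilde is "uncorrected"). 1. *Coarse advancement.* At the boundary between IF-2 and int, tilde and bar data are identified: in formulas with tilde arguments, tilde data on $\mathcal{C}^{\text{int}}$ means the bar data, and in formulas with bar arguments, bar data on $\mathcal{C}^{\text{IF-2}}$ means the tilde data. - For $i\in\mathcal{F}_P^5\cup\mathcal{C}_P^{\text{IF-1}}\cup\mathcal{C}_P^{\text{IF-2}}$: $\tilde h_i^{n+1/3}=h_i^n+\frac{\Delta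 t}{3}\Psi_i(\mathbf{u}^n,\mathbf{h}^n)$, $h_i^*=\beta_1\tilde h_i^{n+1/3}+(1-\beta_1)h_i^n$. For $i\in\mathcal{C}_P^{\text{int}}$: the same formulas with $\bar h_i^{n+1/3}$ in place of $\tilde h_i^{n+1/3}$. - $\tilde u_e^{n+1/3}=u_e^n+\frac{\Delta t}{3}\Phi_e(\mathbf{u}^n,\mathbf{h}^* )$ for $e\in\mathcal{F}_E^4\cup\mathcal{C}_E^{\text{IF-1}}\cup\mathcal{C}_E^{\text{IF-2}}$; $\bar u_e^{n+1/3}$ is given by the same formula for $e\in\mathcal{C}_E^{\text{int}}$. - For $i\in\mathcal{F}_P^3\cup\mathcal{C}_P^{\text{IF-1}}\cup\mathcal{C}_P^{\text{IF-2}}$: $\tilde h_i^{n+1/2}=h_i^n+\frac{\Delta t}{2}\Psi_i(\tilde{\mathbf{u}}^{n+1/3},\tilde{\mathbf{h}}^{n+1/3})$, $h_i^{**}=\beta_2\tilde h_i^{n+1/2}+(1-\beta_2)h_i^n$. For $i\in\mathcal{C}_P^{\text{int}}$: the same with bars in place of tildes. - $\tilde u_e^{n+1/2}=u_e^n+\frac{\Delta t}{2}\Phi_e(\tilde{\mathbf{u}}^{n+1/3},\mathbf{h}^{**})$ for $e\in\mathcal{F}_E^2\cup\mathcal{C}_E^{\text{IF-1}}\cup\mathcal{C}_E^{\text{IF-2}}$; $\bar u_e^{n+1/2}=u_e^n+\frac{\Delta t}{2}\Phi_e(\bar{\mathbf{u}}^{n+1/3},\mathbf{h}^{**})$ for $e\in\mathcal{C}_E^{\text{int}}$.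 - For $i\in\mathcal{F}_P^1\cup\mathcal{C}_P^{\text{IF-1}}\cup\mathcal{C}_P^{\text{IF-2}}$: $\tilde h_i^{n+1}=h_i^n+\Delta t\,\Psi_i(\tilde{\mathbf{u}}^{n+1/2},\tilde{\mathbf{h}}^{n+1/2})$, $h_i^{***}=\beta_3\tilde h_i^{n+1}+(1-2\beta_3)\tilde h_i^{n+1/2}+\beta_3h_i^n$. For $i\in\mathcal{C}_P^{\text{int}}$: $h_i^{n+1}=h_i^n+\Delta t\,\Psi_i(\bar{\mathbf{u}}^{n+1/2},\bar{\mathbf{h}}^{n+1/2})$, $h_i^{***}=\beta_3h_i^{n+1}+(1-2\beta_3)\bar h_i^{n+1/2}+\beta_3h_i^n$. - $\tilde u_e^{n+1}=u_e^n+\Delta t\,\Phi_e(\tilde{\mathbf{u}}^{n+1/2},\mathbf{h}^{***})$ for $e\in\mathcal{C}_E^{\text{IF-1}}$; $u_e^{n+1}=u_e^n+\Delta t\,\Phi_e(\bar{\mathbf{u}}^{n+1/2},\mathbf{h}^{***})$ for $e\in\mathcal{C}_E^{\text{int}}$. 2. *Interface prediction.* On $\mathcal{C}_P^{\text{IF-1}}$ and $\mathcal{C}_E^{\text{IF-1}}$, for $y=h_i$ or $y=u_e$ and $k=0,\dots,M-1$: $y^{n,k}=\frac kM\tilde y^{n+1}+(1-\frac kM)y^n$ (also for $k=M$ for $h$), $\bar y^{n,k+1/3}=\frac kM\tilde y^{n+1}+\frac1M\tilde y^{n+1/3}+(1-\frac{k+1}M)y^n$, $\bar y^{n,k+1/2}=\frac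 kM\tilde y^{n+1}+\frac1M\tilde y^{n+1/2}+(1-\frac{k+1}M)y^n$. For $i\in\mathcal{C}_P^{\text{IF-1}}$ also $h_i^{*,k}=\beta_1\bar h_i^{n,k+1/3}+(1-\beta_1)h_i^{n,k}$, $h_i^{**,k}=\beta_2\bar h_i^{n,k+1/2}+(1-\beta_2)h_i^{n,k}$, $h_i^{***,k}=\beta_3h_i^{n,k+1}+(1-2\beta_3)\bar h_i^{n,k+1/2}+\beta_3h_i^{n,k}$. 3. *Fine advancement.* For $i\in\mathcal{F}_P$, $e\in\mathcal{F}_E$, start from $h_i^{n,0}=h_i^n$, $u_e^{n,0}=u_e^n$, and for $k=0,\dots,M-1$ compute (using predicted data on IF-1 where needed) $\bar h_i^{n,k+1/3}=h_i^{n,k}+\frac{\Delta t}{3M}\Psi_i(\mathbf{u}^{n,k},\mathbf{h}^{n,k})$, $h_i^{*,k}=\beta_1\bar h_i^{n,k+1/3}+(1-\beta_1)h_i^{n,k}$, $\bar u_e^{n,k+1/3}=u_e^{n,k}+\frac{\Delta t}{3M}\Phi_e(\mathbf{u}^{n,k},\mathbf{h}^{*,k})$; $\bar h_i^{n,k+1/2}=h_i^{n,k}+\frac{\Delta t}{2M}\Psi_i(\bar{\mathbf{u}}^{n,k+1/3},\bar{\mathbf{h}}^{n,k+1/3})$, $h_i^{**,k}=\beta_2\bar h_i^{n,k+1/2}+(1-\beta_2)h_i^{n,k}$, $\bar u_e^{n,k+1/2}=u_e^{n,k}+\frac{\Delta t}{2M}\Phi_e(\bar{\mathbf{u}}^{n,k+1/3},\mathbf{h}^{**,k})$;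 $h_i^{n,k+1}=h_i^{n,k}+\frac{\Delta t}{M}\Psi_i(\bar{\mathbf{u}}^{n,k+1/2},\bar{\mathbf{h}}^{n,k+1/2})$, $h_i^{***,k}=\beta_3h_i^{n,k+1}+(1-2\beta_3)\bar h_i^{n,k+1/2}+\beta_3h_i^{n,k}$, $u_e^{n,k+1}=u_e^{n,k}+\frac{\Delta t}{M}\Phi_e(\bar{\mathbf{u}}^{n,k+1/2},\mathbf{h}^{***,k})$. Then set $h_i^{n+1}:=h_i^{n,M}$, $u_e^{n+1}:=u_e^{n,M}$. 4. *Interface correction.* For $i\in\mathcal{C}_P^{\text{IF-1}}\cup\mathcal{C}_P^{\text{IF-2}}$, $e\in\mathcal{C}_E^{\text{IF-1}}\cup\mathcal{C}_E^{\text{IF-2}}$: $h_i^{n+1}=h_i^n+\frac{\Delta t}{M}\sum_{k=0}^{M-1}\Psi_i(\bar{\mathbf{u}}^{n,k+1/2},\bar{\mathbf{h}}^{n,k+1/2})$, $u_e^{n+1}=u_e^n+\frac{\Delta t}{M}\sum_{k=0}^{M-1}\Phi_e(\bar{\mathbf{u}}^{n,k+1/2},\mathbf{h}^{***,k})$, where for every $k$, on $\mathcal{C}^{\text{IF-2}}$ one sets $\bar u_e^{n,k+1/2}:=\tilde u_e^{n+1/2}$, $\bar h_i^{n,k+1/2}:=\tilde h_i^{n+1/2}$, $h_i^{***,k}:=h_i^{***}$, and on $\mathcal{C}^{\text{int}}$ one sets $\bar u_e^{n,k+1/2}:=\bar u_e^{n+1/2}$, $\bar h_i^{n,k+1/2}:=\bar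 h_i^{n+1/2}$, $h_i^{***,k}:=h_i^{***}$. On IF-1 the predicted data, and on the fine region the fine-advancement data, are used. **Advancement of $\eta$ by FB-LTS.** The vorticity equation (the curl of the momentum equation) is advanced with the same stage data as the momentum equation: - for $v\in\mathcal{F}_D$: $\eta_v^{n,0}=\eta_v^n$, $\eta_v^{n,k+1}=\eta_v^{n,k}+\frac{\Delta t}{M}\Theta_v(\bar{\mathbf{u}}^{n,k+1/2},\mathbf{h}^{***,k})$ for $k=0,\dots,M-1$, and $\eta_v^{n+1}:=\eta_v^{n,M}$; - for $v\in\mathcal{C}_D^{\text{IF-1}}\cup\mathcal{C}_D^{\text{IF-2}}$: $\eta_v^{n+1}=\eta_v^n+\frac{\Delta t}{M}\sum_{k=0}^{M-1}\Theta_v(\bar{\mathbf{u}}^{n,k+1/2},\mathbf{h}^{***,k})$, with the same conventions on IF-2 and int data as in step 4; - for $v\in\mathcal{C}_D^{\text{int}}$: $\eta_v^{n+1}=\eta_v^n+\Delta t\,\Theta_v(\bar{\mathbf{u}}^{n+1/2},\mathbf{h}^{***})$, with bar data on $\mathcal{C}^{\text{IF-2}}$ meaning tilde data. *)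

theory Defs
  imports Complex_Main
begin

section \<open>Meshes\<close>

text \<open>
  Combinatorial data of a C-grid mesh.  Dual edges are indexed by the primal edges they cross, so
  one index type serves both, and every per-edge quantity has one value per index.
  \<open>n_outward m e i\<close> says that the unit normal of edge \<open>e\<close> points out of cell \<open>i\<close>;
  \<open>t_outward m e v\<close> says that \<open>t_e = k \<times> n_e\<close> points out of dual cell \<open>v\<close>.
  \<open>corners m v\<close> are the primal cells whose centers are the corners of the dual cell \<open>v\<close>.
\<close>

record ('p, 'e, 'd) mesh =
  cells :: "'p set"
  edges :: "'e set"
  dual_cells :: "'d set"
  cell_area :: "'p \<Rightarrow> real"
  cell_edges :: "'p \<Rightarrow> 'e set"
  edge_length :: "'e \<Rightarrow> real"
  n_outward :: "'e \<Rightarrow> 'p \<Rightarrow> bool"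
  dual_area :: "'d \<Rightarrow> real"
  dual_edges :: "'d \<Rightarrow> 'e set"
  dual_length :: "'e \<Rightarrow> real"
  t_outward :: "'e \<Rightarrow> 'd \<Rightarrow> bool"
  corners :: "'d \<Rightarrow> 'p set"

definition cells_at :: "('p, 'e, 'd) mesh \<Rightarrow> 'e \<Rightarrow> 'p set" where
  "cells_at m e = {i \<in> cells m. e \<in> cell_edges m i}"

definition duals_at :: "('p, 'e, 'd) mesh \<Rightarrow> 'e \<Rightarrow> 'd set" where
  "duals_at m e = {v \<in> dual_cells m. e \<in> dual_edges m v}"

text \<open>
  The conditions on \<open>n_outward\<close> and \<open>t_outward\<close> express that a normal to an edge shared by two
  (dual) cells leaves one of them and enters the other.
\<close>

definition valid_mesh :: "('p, 'e, 'd) mesh \<Rightarrow> bool" where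
  "valid_mesh m \<longleftrightarrow>
     finite (cells m) \<and> finite (edges m) \<and> finite (dual_cells m) \<and>
     (\<forall>i\<in>cells m. cell_edges m i \<subseteq> edges m \<and> 0 < cell_area m i) \<and>
     (\<forall>v\<in>dual_cells m. dual_edges m v \<subseteq> edges m \<and> 0 < dual_area m v \<and>
        corners m v \<subseteq> cells m \<and> corners m v \<noteq> {}) \<and>
     (\<forall>v\<in>dual_cells m. \<forall>e\<in>dual_edges m v. cells_at m e \<subseteq> corners m v) \<and>
     (\<forall>e\<in>edges m. 0 < edge_length m e \<and> 0 < dual_length m e) \<and>
     (\<forall>e\<in>edges m. card (cells_at m e) \<in> {1, 2}) \<and>
     (\<forall>e\<in>edges m. \<forall>i\<in>cells_at m e. \<forall>j\<in>cells_at m e.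
        i \<noteq> j \<longrightarrow> n_outward m e i \<noteq> n_outward m e j) \<and>
     (\<forall>e\<in>edges m. card (duals_at m e) \<le> 2) \<and>
     (\<forall>e\<in>edges m. \<forall>v\<in>duals_at m e. \<forall>w\<in>duals_at m e.
        v \<noteq> w \<longrightarrow> t_outward m e v \<noteq> t_outward m e w)"

definition n_sign :: "('p, 'e, 'd) mesh \<Rightarrow> 'e \<Rightarrow> 'p \<Rightarrow> real" where
  "n_sign m e i = (if n_outward m e i then 1 else -1)"

definition t_sign :: "('p, 'e, 'd) mesh \<Rightarrow> 'e \<Rightarrow> 'd \<Rightarrow> real" where
  "t_sign m e v = (if t_outward m e v then -1 else 1)"

definition edges_touching :: "('p, 'e, 'd) mesh \<Rightarrow> 'p set \<Rightarrow> 'e set" where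
  "edges_touching m S = {e \<in> edges m. cells_at m e \<inter> S \<noteq> {}}"

primrec cell_layers :: "('p, 'e, 'd) mesh \<Rightarrow> 'p set \<Rightarrow> nat \<Rightarrow> 'p set" where
  "cell_layers m S 0 = S"
| "cell_layers m S (Suc n) = cell_layers m S n \<union>
     {i \<in> cells m. \<exists>j\<in>cell_layers m S n. cell_edges m i \<inter> cell_edges m j \<noteq> {}}"


section \<open>TRiSK operators\<close>

text \<open>
  A discrete state is a pair of fields \<open>u\<close> (normal velocities on edges) and \<open>h\<close> (thicknesses on
  cells).  \<open>flux T e (u e) h\<close> is \<open>F_e(u_e, h)\<close>, \<open>Phi T u h e\<close> the discretized momentum tendency and
  \<open>pv_edge T u h e\<close> the potential vorticity interpolated to edge \<open>e\<close>.  The linear flux mapping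
  operator is given by its matrix \<open>flux_weight T e e'\<close>.
\<close>

record ('p, 'e) trisk =
  flux :: "'e \<Rightarrow> real \<Rightarrow> ('p \<Rightarrow> real) \<Rightarrow> real"
  Phi :: "('e \<Rightarrow> real) \<Rightarrow> ('p \<Rightarrow> real) \<Rightarrow> 'e \<Rightarrow> real"
  pv_edge :: "('e \<Rightarrow> real) \<Rightarrow> ('p \<Rightarrow> real) \<Rightarrow> 'e \<Rightarrow> real"
  flux_weight :: "'e \<Rightarrow> 'e \<Rightarrow> real"

definition flux_map :: "('p, 'e, 'd) mesh \<Rightarrow> ('p, 'e) trisk \<Rightarrow> ('e \<Rightarrow> real) \<Rightarrow> 'e \<Rightarrow> real" where
  "flux_map m T G e = (\<Sum>e'\<in>edges m. flux_weight T e e' * G e')"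

definition flux_perp ::
  "('p, 'e, 'd) mesh \<Rightarrow> ('p, 'e) trisk \<Rightarrow> ('e \<Rightarrow> real) \<Rightarrow> ('p \<Rightarrow> real) \<Rightarrow> 'e \<Rightarrow> real" where
  "flux_perp m T u h = flux_map m T (\<lambda>e. flux T e (u e) h)"

definition Psi ::
  "('p, 'e, 'd) mesh \<Rightarrow> ('p, 'e) trisk \<Rightarrow> ('e \<Rightarrow> real) \<Rightarrow> ('p \<Rightarrow> real) \<Rightarrow> 'p \<Rightarrow> real" where
  "Psi m T u h i = (-1 / cell_area m i) *
     (\<Sum>e\<in>cell_edges m i. n_sign m e i * edge_length m e * flux T e (u e) h)"

definition Theta ::
  "('p, 'e, 'd) mesh \<Rightarrow> ('p, 'e) trisk \<Rightarrow> ('e \<Rightarrow> real) \<Rightarrow> ('p \<Rightarrow> real) \<Rightarrow> 'd \<Rightarrow> real" where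
  "Theta m T u h v = (-1 / dual_area m v) *
     (\<Sum>e\<in>dual_edges m v. - t_sign m e v * dual_length m e * pv_edge T u h e * flux_perp m T u h e)"

definition no_boundary :: "('p, 'e, 'd) mesh \<Rightarrow> bool" where
  "no_boundary m \<longleftrightarrow> (\<forall>v\<in>dual_cells m. \<forall>e\<in>dual_edges m v. card (duals_at m e) = 2)"

text \<open>
  A dual edge on the domain boundary belongs to a single dual cell.  The normal transport through
  dual edge \<open>e\<close> is \<open>flux_perp m T u h e\<close>.
\<close>

definition no_flow ::
  "('p, 'e, 'd) mesh \<Rightarrow> ('p, 'e) trisk \<Rightarrow> ('e \<Rightarrow> real) \<Rightarrow> ('p \<Rightarrow> real) \<Rightarrow> bool" where
  "no_flow m T u h \<longleftrightarrow> (\<forall>e\<in>edges m. card (duals_at m e) = 1 \<longrightarrow> flux_perp m T u h e = 0)"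


section \<open>Regions for local time-stepping\<close>

datatype region = Fine | IF1 | IF2 | Interior

primrec region_rank :: "region \<Rightarrow> nat" where
  "region_rank Fine = 0"
| "region_rank IF1 = 1"
| "region_rank IF2 = 2"
| "region_rank Interior = 3"

definition near :: "region \<Rightarrow> region \<Rightarrow> bool" where
  "near R S \<longleftrightarrow> region_rank R \<le> region_rank S + 1 \<and> region_rank S \<le> region_rank R + 1"

definition closest_region :: "('p \<Rightarrow> region) \<Rightarrow> 'p set \<Rightarrow> region \<Rightarrow> bool" where
  "closest_region reg S R \<longleftrightarrow>
     (\<exists>i\<in>S. reg i = R) \<and> (\<forall>i\<in>S. region_rank R \<le> region_rank (reg i))"

definition cells_in :: "('p, 'e, 'd) mesh \<Rightarrow> ('p \<Rightarrow> region) \<Rightarrow> region \<Rightarrow> 'p set" where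
  "cells_in m reg R = {i \<in> cells m. reg i = R}"

definition edges_in :: "('p, 'e, 'd) mesh \<Rightarrow> ('p \<Rightarrow> region) \<Rightarrow> region \<Rightarrow> 'e set" where
  "edges_in m reg R = {e \<in> edges m. closest_region reg (cells_at m e) R}"

definition duals_in :: "('p, 'e, 'd) mesh \<Rightarrow> ('p \<Rightarrow> region) \<Rightarrow> region \<Rightarrow> 'd set" where
  "duals_in m reg R = {v \<in> dual_cells m. closest_region reg (corners m v) R}"

definition lts_regions :: "('p, 'e, 'd) mesh \<Rightarrow> ('p \<Rightarrow> region) \<Rightarrow> bool" where
  "lts_regions m reg \<longleftrightarrow>
     (\<forall>e\<in>edges m. \<forall>i\<in>cells_at m e. \<forall>j\<in>cells_at m e. near (reg i) (reg j))"

definition fine_cell_layers ::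
  "('p, 'e, 'd) mesh \<Rightarrow> ('p \<Rightarrow> region) \<Rightarrow> nat \<Rightarrow> nat \<Rightarrow> 'p set" where
  "fine_cell_layers m reg r l =
     cells_in m reg Fine \<inter> cell_layers m (cells m - cells_in m reg Fine) (l * r)"

definition fine_edge_layers ::
  "('p, 'e, 'd) mesh \<Rightarrow> ('p \<Rightarrow> region) \<Rightarrow> nat \<Rightarrow> nat \<Rightarrow> 'e set" where
  "fine_edge_layers m reg r l =
     edges_in m reg Fine \<inter> edges_touching m (fine_cell_layers m reg r l)"

definition depends_on ::
  "(('e \<Rightarrow> real) \<Rightarrow> ('p \<Rightarrow> real) \<Rightarrow> real) \<Rightarrow> 'e set \<Rightarrow> 'p set \<Rightarrow> bool" where
  "depends_on f SE SP \<longleftrightarrow>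
     (\<forall>u u' h h'. (\<forall>e\<in>SE. u e = u' e) \<and> (\<forall>i\<in>SP. h i = h' i) \<longrightarrow> f u h = f u' h')"

text \<open>
  The first layer around an edge consists of the cells sharing it, hence the \<open>r - 1\<close>.  With this
  convention \<open>l * r\<close> layers of fine cells contain all uncorrected data needed at each stage.
\<close>

definition stencil_radius :: "('p, 'e, 'd) mesh \<Rightarrow> ('p, 'e) trisk \<Rightarrow> nat \<Rightarrow> bool" where
  "stencil_radius m T r \<longleftrightarrow> 1 \<le> r \<and>
     (\<forall>e\<in>edges m. let S = cell_layers m (cells_at m e) (r - 1) in
        depends_on (\<lambda>u h. Phi T u h e) (edges_touching m S) S) \<and>
     (\<forall>i\<in>cells m. let S = cell_layers m {i} r in
        depends_on (\<lambda>u h. Psi m T u h i) (edges_touching m S) S)"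

definition region_local ::
  "('p, 'e, 'd) mesh \<Rightarrow> ('p \<Rightarrow> region) \<Rightarrow> region \<Rightarrow>
   (('e \<Rightarrow> real) \<Rightarrow> ('p \<Rightarrow> real) \<Rightarrow> real) \<Rightarrow> bool" where
  "region_local m reg R f \<longleftrightarrow>
     depends_on f (\<Union>S\<in>{S. near R S}. edges_in m reg S) (\<Union>S\<in>{S. near R S}. cells_in m reg S)"

definition region_stencils ::
  "('p, 'e, 'd) mesh \<Rightarrow> ('p, 'e) trisk \<Rightarrow> ('p \<Rightarrow> region) \<Rightarrow> bool" where
  "region_stencils m T reg \<longleftrightarrow>
     (\<forall>R. \<forall>e\<in>edges_in m reg R. region_local m reg R (\<lambda>u h. Phi T u h e)) \<and>
     (\<forall>R. \<forall>i\<in>cells_in m reg R. region_local m reg R (\<lambda>u h. Psi m T u h i) \<and>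
        (\<forall>e\<in>cell_edges m i. region_local m reg R (\<lambda>u h. flux T e (u e) h))) \<and>
     (\<forall>R. \<forall>v\<in>duals_in m reg R. region_local m reg R (\<lambda>u h. Theta m T u h v) \<and>
        (\<forall>e\<in>dual_edges m v.
           region_local m reg R (\<lambda>u h. pv_edge T u h e * flux_perp m T u h e)))"


section \<open>One coarse step of FB-LTS\<close>

text \<open>
  All intermediate data of a step.  Prefix \<open>t\<close> stands for a tilde, \<open>b\<close> for a bar; suffixes \<open>13\<close>,
  \<open>12\<close>, \<open>1\<close> for the time levels n+1/3, n+1/2, n+1; \<open>s\<close>, \<open>ss\<close>, \<open>sss\<close> for one, two, three stars;
  suffix \<open>k\<close> marks data of the fine substeps, whose first argument is the substep number.
  The fields are total functions, but the scheme below only constrains them where it assigns them;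
  elsewhere their values are arbitrary.
\<close>

record ('p, 'e) stages =
  th13 :: "'p \<Rightarrow> real"  bh13 :: "'p \<Rightarrow> real"  hs :: "'p \<Rightarrow> real"
  tu13 :: "'e \<Rightarrow> real"  bu13 :: "'e \<Rightarrow> real"
  th12 :: "'p \<Rightarrow> real"  bh12 :: "'p \<Rightarrow> real"  hss :: "'p \<Rightarrow> real"
  tu12 :: "'e \<Rightarrow> real"  bu12 :: "'e \<Rightarrow> real"
  th1 :: "'p \<Rightarrow> real"  hsss :: "'p \<Rightarrow> real"
  tu1 :: "'e \<Rightarrow> real"
  hk :: "nat \<Rightarrow> 'p \<Rightarrow> real"  uk :: "nat \<Rightarrow> 'e \<Rightarrow> real"
  bh13k :: "nat \<Rightarrow> 'p \<Rightarrow> real"  hsk :: "nat \<Rightarrow> 'p \<Rightarrow> real"  bu13k :: "nat \<Rightarrow> 'e \<Rightarrow> real"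
  bh12k :: "nat \<Rightarrow> 'p \<Rightarrow> real"  hssk :: "nat \<Rightarrow> 'p \<Rightarrow> real"  bu12k :: "nat \<Rightarrow> 'e \<Rightarrow> real"
  hsssk :: "nat \<Rightarrow> 'p \<Rightarrow> real"

record fb_params =
  dt :: real
  nsub :: nat
  beta1 :: real
  beta2 :: real
  beta3 :: real

text \<open>
  Arguments of the coarse operators: \<open>tilde_e\<close>, \<open>tilde_p\<close> read bar data on the interior coarse
  region, \<open>bar_e\<close>, \<open>bar_p\<close> read tilde data on interface two.
\<close>

definition tilde_e ::
  "('p, 'e, 'd) mesh \<Rightarrow> ('p \<Rightarrow> region) \<Rightarrow> ('e \<Rightarrow> real) \<Rightarrow> ('e \<Rightarrow> real) \<Rightarrow> 'e \<Rightarrow> real" where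
  "tilde_e m reg t b = override_on t b (edges_in m reg Interior)"

definition tilde_p ::
  "('p, 'e, 'd) mesh \<Rightarrow> ('p \<Rightarrow> region) \<Rightarrow> ('p \<Rightarrow> real) \<Rightarrow> ('p \<Rightarrow> real) \<Rightarrow> 'p \<Rightarrow> real" where
  "tilde_p m reg t b = override_on t b (cells_in m reg Interior)"

definition bar_e ::
  "('p, 'e, 'd) mesh \<Rightarrow> ('p \<Rightarrow> region) \<Rightarrow> ('e \<Rightarrow> real) \<Rightarrow> ('e \<Rightarrow> real) \<Rightarrow> 'e \<Rightarrow> real" where
  "bar_e m reg t b = override_on b t (edges_in m reg IF2)"

definition bar_p ::
  "('p, 'e, 'd) mesh \<Rightarrow> ('p \<Rightarrow> region) \<Rightarrow> ('p \<Rightarrow> real) \<Rightarrow> ('p \<Rightarrow> real) \<Rightarrow> 'p \<Rightarrow> real" where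
  "bar_p m reg t b = override_on b t (cells_in m reg IF2)"

text \<open>In the step predicates, \<open>u', h'\<close> is the state at the new coarse time level.\<close>

definition coarse_advancement ::
  "('p, 'e, 'd) mesh \<Rightarrow> ('p, 'e) trisk \<Rightarrow> ('p \<Rightarrow> region) \<Rightarrow> nat \<Rightarrow> fb_params \<Rightarrow>
   ('e \<Rightarrow> real) \<Rightarrow> ('p \<Rightarrow> real) \<Rightarrow> ('p, 'e) stages \<Rightarrow> ('e \<Rightarrow> real) \<Rightarrow> ('p \<Rightarrow> real) \<Rightarrow> bool" where
  "coarse_advancement m T reg r P u h D u' h' \<longleftrightarrow>
     (let \<Delta> = dt P; PI = cells_in m reg Interior; EI = edges_in m reg Interior;
          P12 = cells_in m reg IF1 \<union> cells_in m reg IF2; E12 = edges_in m reg IF1 \<union> edges_in m reg IF2;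
          FP = fine_cell_layers m reg r; FE = fine_edge_layers m reg r;
          tu13' = tilde_e m reg (tu13 D) (bu13 D); bu13' = bar_e m reg (tu13 D) (bu13 D);
          th13' = tilde_p m reg (th13 D) (bh13 D); bh13' = bar_p m reg (th13 D) (bh13 D);
          tu12' = tilde_e m reg (tu12 D) (bu12 D); bu12' = bar_e m reg (tu12 D) (bu12 D);
          th12' = tilde_p m reg (th12 D) (bh12 D); bh12' = bar_p m reg (th12 D) (bh12 D)
      in
       (\<forall>i \<in> FP 5 \<union> P12.
          th13 D i = h i + \<Delta> / 3 * Psi m T u h i \<and>
          hs D i = beta1 P * th13 D i + (1 - beta1 P) * h i) \<and>
       (\<forall>i \<in> PI.
          bh13 D i = h i + \<Delta> / 3 * Psi m T u h i \<and>
          hs D i = beta1 P * bh13 D i + (1 - beta1 P) * h i) \<and>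
       (\<forall>e \<in> FE 4 \<union> E12. tu13 D e = u e + \<Delta> / 3 * Phi T u (hs D) e) \<and>
       (\<forall>e \<in> EI. bu13 D e = u e + \<Delta> / 3 * Phi T u (hs D) e) \<and>
       (\<forall>i \<in> FP 3 \<union> P12.
          th12 D i = h i + \<Delta> / 2 * Psi m T tu13' th13' i \<and>
          hss D i = beta2 P * th12 D i + (1 - beta2 P) * h i) \<and>
       (\<forall>i \<in> PI.
          bh12 D i = h i + \<Delta> / 2 * Psi m T bu13' bh13' i \<and>
          hss D i = beta2 P * bh12 D i + (1 - beta2 P) * h i) \<and>
       (\<forall>e \<in> FE 2 \<union> E12. tu12 D e = u e + \<Delta> / 2 * Phi T tu13' (hss D) e) \<and>
       (\<forall>e \<in> EI. bu12 D e = u e + \<Delta> / 2 * Phi T bu13' (hss D) e) \<and>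
       (\<forall>i \<in> FP 1 \<union> P12.
          th1 D i = h i + \<Delta> * Psi m T tu12' th12' i \<and>
          hsss D i = beta3 P * th1 D i + (1 - 2 * beta3 P) * th12 D i + beta3 P * h i) \<and>
       (\<forall>i \<in> PI.
          h' i = h i + \<Delta> * Psi m T bu12' bh12' i \<and>
          hsss D i = beta3 P * h' i + (1 - 2 * beta3 P) * bh12 D i + beta3 P * h i) \<and>
       (\<forall>e \<in> edges_in m reg IF1. tu1 D e = u e + \<Delta> * Phi T tu12' (hsss D) e) \<and>
       (\<forall>e \<in> EI. u' e = u e + \<Delta> * Phi T bu12' (hsss D) e))"

definition interface_prediction ::
  "('p, 'e, 'd) mesh \<Rightarrow> ('p \<Rightarrow> region) \<Rightarrow> fb_params \<Rightarrow>
   ('e \<Rightarrow> real) \<Rightarrow> ('p \<Rightarrow> real) \<Rightarrow> ('p, 'e) stages \<Rightarrow> bool" where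
  "interface_prediction m reg P u h D \<longleftrightarrow>
     (let M = real (nsub P) in
       (\<forall>i \<in> cells_in m reg IF1.
         (\<forall>k \<le> nsub P. hk D k i = real k / M * th1 D i + (1 - real k / M) * h i) \<and>
         (\<forall>k < nsub P.
           bh13k D k i = real k / M * th1 D i + 1 / M * th13 D i + (1 - (real k + 1) / M) * h i \<and>
           bh12k D k i = real k / M * th1 D i + 1 / M * th12 D i + (1 - (real k + 1) / M) * h i \<and>
           hsk D k i = beta1 P * bh13k D k i + (1 - beta1 P) * hk D k i \<and>
           hssk D k i = beta2 P * bh12k D k i + (1 - beta2 P) * hk D k i \<and>
           hsssk D k i = beta3 P * hk D (Suc k) i + (1 - 2 * beta3 P) * bh12k D k i
                           + beta3 P * hk D k i)) \<and>
       (\<forall>e \<in> edges_in m reg IF1. \<forall>k < nsub P.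
           uk D k e = real k / M * tu1 D e + (1 - real k / M) * u e \<and>
           bu13k D k e = real k / M * tu1 D e + 1 / M * tu13 D e + (1 - (real k + 1) / M) * u e \<and>
           bu12k D k e = real k / M * tu1 D e + 1 / M * tu12 D e + (1 - (real k + 1) / M) * u e))"

definition fine_advancement ::
  "('p, 'e, 'd) mesh \<Rightarrow> ('p, 'e) trisk \<Rightarrow> ('p \<Rightarrow> region) \<Rightarrow> fb_params \<Rightarrow>
   ('e \<Rightarrow> real) \<Rightarrow> ('p \<Rightarrow> real) \<Rightarrow> ('p, 'e) stages \<Rightarrow> ('e \<Rightarrow> real) \<Rightarrow> ('p \<Rightarrow> real) \<Rightarrow> bool" where
  "fine_advancement m T reg P u h D u' h' \<longleftrightarrow>
     (let \<delta> = dt P / real (nsub P) in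
       (\<forall>i \<in> cells_in m reg Fine.
         hk D 0 i = h i \<and> h' i = hk D (nsub P) i \<and>
         (\<forall>k < nsub P.
           bh13k D k i = hk D k i + \<delta> / 3 * Psi m T (uk D k) (hk D k) i \<and>
           hsk D k i = beta1 P * bh13k D k i + (1 - beta1 P) * hk D k i \<and>
           bh12k D k i = hk D k i + \<delta> / 2 * Psi m T (bu13k D k) (bh13k D k) i \<and>
           hssk D k i = beta2 P * bh12k D k i + (1 - beta2 P) * hk D k i \<and>
           hk D (Suc k) i = hk D k i + \<delta> * Psi m T (bu12k D k) (bh12k D k) i \<and>
           hsssk D k i = beta3 P * hk D (Suc k) i + (1 - 2 * beta3 P) * bh12k D k i
                           + beta3 P * hk D k i)) \<and>
       (\<forall>e \<in> edges_in m reg Fine.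
         uk D 0 e = u e \<and> u' e = uk D (nsub P) e \<and>
         (\<forall>k < nsub P.
           bu13k D k e = uk D k e + \<delta> / 3 * Phi T (uk D k) (hsk D k) e \<and>
           bu12k D k e = uk D k e + \<delta> / 2 * Phi T (bu13k D k) (hssk D k) e \<and>
           uk D (Suc k) e = uk D k e + \<delta> * Phi T (bu12k D k) (hsssk D k) e)))"

definition interface_correction ::
  "('p, 'e, 'd) mesh \<Rightarrow> ('p, 'e) trisk \<Rightarrow> ('p \<Rightarrow> region) \<Rightarrow> fb_params \<Rightarrow>
   ('e \<Rightarrow> real) \<Rightarrow> ('p \<Rightarrow> real) \<Rightarrow> ('p, 'e) stages \<Rightarrow> ('e \<Rightarrow> real) \<Rightarrow> ('p \<Rightarrow> real) \<Rightarrow> bool" where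
  "interface_correction m T reg P u h D u' h' \<longleftrightarrow>
     (let \<delta> = dt P / real (nsub P) in
       (\<forall>k < nsub P.
         (\<forall>e \<in> edges_in m reg IF2. bu12k D k e = tu12 D e) \<and>
         (\<forall>i \<in> cells_in m reg IF2. bh12k D k i = th12 D i \<and> hsssk D k i = hsss D i) \<and>
         (\<forall>e \<in> edges_in m reg Interior. bu12k D k e = bu12 D e) \<and>
         (\<forall>i \<in> cells_in m reg Interior. bh12k D k i = bh12 D i \<and> hsssk D k i = hsss D i)) \<and>
       (\<forall>i \<in> cells_in m reg IF1 \<union> cells_in m reg IF2.
         h' i = h i + \<delta> * (\<Sum>k<nsub P. Psi m T (bu12k D k) (bh12k D k) i)) \<and>
       (\<forall>e \<in> edges_in m reg IF1 \<union> edges_in m reg IF2.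
         u' e = u e + \<delta> * (\<Sum>k<nsub P. Phi T (bu12k D k) (hsssk D k) e)))"

definition fb_lts_step ::
  "('p, 'e, 'd) mesh \<Rightarrow> ('p, 'e) trisk \<Rightarrow> ('p \<Rightarrow> region) \<Rightarrow> nat \<Rightarrow> fb_params \<Rightarrow>
   ('e \<Rightarrow> real) \<Rightarrow> ('p \<Rightarrow> real) \<Rightarrow> ('p, 'e) stages \<Rightarrow> ('e \<Rightarrow> real) \<Rightarrow> ('p \<Rightarrow> real) \<Rightarrow> bool" where
  "fb_lts_step m T reg r P u h D u' h' \<longleftrightarrow>
     coarse_advancement m T reg r P u h D u' h' \<and>
     interface_prediction m reg P u h D \<and>
     fine_advancement m T reg P u h D u' h' \<and>
     interface_correction m T reg P u h D u' h'"

definition vorticity_step ::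
  "('p, 'e, 'd) mesh \<Rightarrow> ('p, 'e) trisk \<Rightarrow> ('p \<Rightarrow> region) \<Rightarrow> fb_params \<Rightarrow>
   ('p, 'e) stages \<Rightarrow> ('d \<Rightarrow> real) \<Rightarrow> (nat \<Rightarrow> 'd \<Rightarrow> real) \<Rightarrow> ('d \<Rightarrow> real) \<Rightarrow> bool" where
  "vorticity_step m T reg P D \<eta> \<eta>k \<eta>' \<longleftrightarrow>
     (let \<delta> = dt P / real (nsub P) in
       (\<forall>v \<in> duals_in m reg Fine.
         \<eta>k 0 v = \<eta> v \<and> \<eta>' v = \<eta>k (nsub P) v \<and>
         (\<forall>k < nsub P. \<eta>k (Suc k) v = \<eta>k k v + \<delta> * Theta m T (bu12k D k) (hsssk D k) v)) \<and>
       (\<forall>v \<in> duals_in m reg IF1 \<union> duals_in m reg IF2.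
         \<eta>' v = \<eta> v + \<delta> * (\<Sum>k<nsub P. Theta m T (bu12k D k) (hsssk D k) v)) \<and>
       (\<forall>v \<in> duals_in m reg Interior.
         \<eta>' v = \<eta> v + dt P * Theta m T (bar_e m reg (tu12 D) (bu12 D)) (hsss D) v))"

end

theory Submission
  imports Defs
begin

text \<open>
  Conservation holds because every region of the mesh is advanced, in effect, by the same sequence of
  vorticity fluxes.  For one fixed discrete state the tendencies \<open>Theta\<close>, weighted by the dual
  areas, sum to zero: a dual edge shared by two dual cells contributes the same flux to both of them
  with opposite signs, and a dual edge on the boundary carries no flux
  (\<open>sum_area_Theta_eq_0\<close>).  It therefore suffices that on \<^emph>\<open>every\<close> dual cell the increment over the
  coarse step is \<open>\<Delta>t / M\<close> times the sum over the \<open>M\<close> substeps of \<open>Theta\<close> at one and the same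
  global substep state, in which the regions are glued together (\<open>vorticity_step_accumulated\<close>).

  On the two interface regions this is the definition of the correction step, and on the fine region
  the substeps telescope.  The interior coarse region takes a single step of length \<open>\<Delta>t\<close>; but
  there the stencil reaches no further than interface two, where the substep data do not change
  from one substep to the next, so that \<open>M\<close> equal substeps amount to the single coarse step
  (\<open>interior_Theta_substep\<close>).
\<close>

section \<open>Cancellation of vorticity fluxes for a fixed state\<close>

text \<open>
  The outward normal of a dual edge for one of its dual cells is the inward normal for the other.
\<close>

lemma sum_t_sign_eq_0:
  assumes "valid_mesh m" "e \<in> edges m" "card (duals_at m e) = 2"
  shows "(\<Sum>v\<in>duals_at m e. t_sign m e v) = 0"
proof -
  obtain v w where vw: "duals_at m e = {v, w}" "v \<noteq> w"
    using assms(3) by (meson card_2_iff)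
  then have "t_outward m e v \<noteq> t_outward m e w"
    using assms(1,2) unfolding valid_mesh_def by blast
  then show ?thesis
    using vw by (auto simp: t_sign_def)
qed

text \<open>
  The discrete divergence theorem: exchanging the sums over dual cells and over their edges
  collects, for each dual edge, its contributions to the dual cells at its two sides.
\<close>

lemma sum_area_Theta_eq_0:
  assumes mesh: "valid_mesh m"
    and bd: "no_boundary m \<or> no_flow m T u h"
  shows "(\<Sum>v\<in>dual_cells m. dual_area m v * Theta m T u h v) = 0"
proof -
  define q where "q e = dual_length m e * pv_edge T u h e * flux_perp m T u h e" for e
  have fin: "finite (dual_cells m)" "finite (edges m)"
    and sub: "\<And>v. v \<in> dual_cells m \<Longrightarrow> dual_edges m v \<subseteq> edges m"
    and area: "\<And>v. v \<in> dual_cells m \<Longrightarrow> 0 < dual_area m v"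
    and card_le: "\<And>e. e \<in> edges m \<Longrightarrow> card (duals_at m e) \<le> 2"
    using mesh unfolding valid_mesh_def by auto
  have "(\<Sum>v\<in>dual_cells m. dual_area m v * Theta m T u h v)
      = (\<Sum>v\<in>dual_cells m. \<Sum>e\<in>dual_edges m v. t_sign m e v * q e)"
    using area by (intro sum.cong refl)
      (fastforce simp: Theta_def q_def sum_negf mult.assoc)
  also have "\<dots> = (\<Sum>v\<in>dual_cells m. \<Sum>e | e \<in> edges m \<and> e \<in> dual_edges m v. t_sign m e v * q e)"
    using sub by (intro sum.cong refl) auto
  also have "\<dots> = (\<Sum>e\<in>edges m. \<Sum>v\<in>duals_at m e. t_sign m e v * q e)"
    unfolding duals_at_def by (rule sum.swap_restrict[OF fin])
  also have "\<dots> = 0"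
  proof (rule sum.neutral, rule ballI)
    fix e assume e: "e \<in> edges m"
    have sum_q: "(\<Sum>v\<in>duals_at m e. t_sign m e v * q e) = (\<Sum>v\<in>duals_at m e. t_sign m e v) * q e"
      by (simp add: sum_distrib_right)
    have "finite (duals_at m e)"
      using fin(1) by (simp add: duals_at_def)
    with card_le[OF e] consider "duals_at m e = {}" | "card (duals_at m e) = 1" | "card (duals_at m e) = 2"
      by (metis One_nat_def card_0_eq le_antisym le_numeral_extra(4) nat_le_linear
          not_less_eq_eq numeral_2_eq_2 le_zero_eq)
    then show "(\<Sum>v\<in>duals_at m e. t_sign m e v * q e) = 0"
    proof cases
      case 1
      then show ?thesis by simp
    next
      case 2
      then obtain v where "v \<in> duals_at m e"
        by fastforce
      then have "\<not> no_boundary m"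
        using 2 by (force simp: no_boundary_def duals_at_def)
      then show ?thesis
        using bd 2 e by (simp add: no_flow_def q_def)
    next
      case 3
      then show ?thesis
        using sum_t_sign_eq_0[OF mesh e] by (simp add: sum_q)
    qed
  qed
  finally show ?thesis .
qed

section \<open>All regions accumulate the same substep tendencies\<close>

lemma closest_region_exists:
  assumes "S \<noteq> {}"
  shows "\<exists>R. closest_region reg S R"
proof -
  obtain i where "i \<in> S" "\<forall>j. j \<in> S \<longrightarrow> region_rank (reg i) \<le> region_rank (reg j)"
    using assms ex_has_least_nat[of "\<lambda>i. i \<in> S" _ "\<lambda>i. region_rank (reg i)"] by blast
  then show ?thesis
    unfolding closest_region_def by blast
qed

lemma closest_region_unique:
  assumes "closest_region reg S R" "closest_region reg S R'"
  shows "R = R'"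
proof -
  have "region_rank R = region_rank R'"
    using assms unfolding closest_region_def by (metis le_antisym)
  then show ?thesis
    by (cases R; cases R') auto
qed

lemma dual_cell_cases:
  assumes "valid_mesh m" "v \<in> dual_cells m"
  obtains "v \<in> duals_in m reg Fine" | "v \<in> duals_in m reg IF1 \<union> duals_in m reg IF2"
    | "v \<in> duals_in m reg Interior"
proof -
  obtain R where "closest_region reg (corners m v) R"
    using assms closest_region_exists unfolding valid_mesh_def by metis
  then have "v \<in> duals_in m reg R"
    using assms(2) by (simp add: duals_in_def)
  then show ?thesis
    using that by (cases R) auto
qed

lemma near_Interior: "near Interior S \<longleftrightarrow> S = IF2 \<or> S = Interior"
  by (cases S) (auto simp: near_def)

text \<open>
  Next to the interior coarse region the data entering the coarse step agree with those of each
  substep, since the correction step freezes the latter on interface two and on the interior.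
  Without this, the flux through a dual edge between these two regions would be counted with
  different values on its two sides.
\<close>

lemma interior_Theta_substep:
  assumes st: "region_stencils m T reg"
    and ic: "interface_correction m T reg P u h D u' h'"
    and v: "v \<in> duals_in m reg Interior"
    and k: "k < nsub P"
  shows "Theta m T (bu12k D k) (hsssk D k) v
       = Theta m T (bar_e m reg (tu12 D) (bu12 D)) (hsss D) v"
proof -
  have "region_local m reg Interior (\<lambda>u h. Theta m T u h v)"
    using st v unfolding region_stencils_def by blast
  moreover have "bu12k D k e = bar_e m reg (tu12 D) (bu12 D) e"
    if e: "e \<in> (\<Union>S\<in>{S. near Interior S}. edges_in m reg S)" for e
  proof -
    consider "e \<in> edges_in m reg IF2" | "e \<in> edges_in m reg Interior"
      using e by (auto simp: near_Interior)
    then show ?thesis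
    proof cases
      case 1
      then show ?thesis
        using ic k by (simp add: interface_correction_def Let_def bar_e_def)
    next
      case 2
      then have "e \<notin> edges_in m reg IF2"
        using closest_region_unique by (fastforce simp: edges_in_def)
      with 2 show ?thesis
        using ic k by (simp add: interface_correction_def Let_def bar_e_def)
    qed
  qed
  moreover have "hsssk D k i = hsss D i"
    if "i \<in> (\<Union>S\<in>{S. near Interior S}. cells_in m reg S)" for i
    using that ic k by (auto simp: near_Interior interface_correction_def Let_def)
  ultimately show ?thesis
    unfolding region_local_def depends_on_def by blast
qed

lemma vorticity_step_accumulated:
  assumes mesh: "valid_mesh m"
    and st: "region_stencils m T reg"
    and M: "0 < nsub P"
    and step: "fb_lts_step m T reg r P u h D u' h'"
    and vort: "vorticity_step m T reg P D \<eta> \<eta>k \<eta>'"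
    and v: "v \<in> dual_cells m"
  shows "\<eta>' v = \<eta> v + dt P / real (nsub P) * (\<Sum>k<nsub P. Theta m T (bu12k D k) (hsssk D k) v)"
  using mesh v
proof (cases rule: dual_cell_cases[of m v reg])
  case 1
  define \<theta> where "\<theta> k = Theta m T (bu12k D k) (hsssk D k) v" for k
  have start: "\<eta>k 0 v = \<eta> v" and end_val: "\<eta>' v = \<eta>k (nsub P) v"
    and substep: "\<And>k. k < nsub P \<Longrightarrow> \<eta>k (Suc k) v = \<eta>k k v + dt P / real (nsub P) * \<theta> k"
    using vort 1 unfolding vorticity_step_def Let_def \<theta>_def by blast+
  have "n \<le> nsub P \<Longrightarrow> \<eta>k n v = \<eta> v + dt P / real (nsub P) * (\<Sum>k<n. \<theta> k)" for n
    by (induction n) (simp_all add: start substep distrib_left)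
  from this[of "nsub P"] show ?thesis
    by (simp add: end_val \<theta>_def)
next
  case 2
  then show ?thesis
    using vort unfolding vorticity_step_def Let_def by blast
next
  case 3
  define \<theta> where "\<theta> = Theta m T (bar_e m reg (tu12 D) (bu12 D)) (hsss D) v"
  have "interface_correction m T reg P u h D u' h'"
    using step by (simp add: fb_lts_step_def)
  then have "(\<Sum>k<nsub P. Theta m T (bu12k D k) (hsssk D k) v) = real (nsub P) * \<theta>"
    using interior_Theta_substep[OF st _ 3] by (simp add: \<theta>_def)
  moreover have "\<eta>' v = \<eta> v + dt P * \<theta>"
    using vort 3 unfolding vorticity_step_def Let_def \<theta>_def by blast
  ultimately show ?thesis
    using M by simp
qed

section \<open>Conservation of absolute vorticity\<close>

text \<open>
  Summing the accumulated increments over all dual cells and exchanging this sum with the one over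
  the substeps leaves, for each substep, a total tendency at a single global state, which vanishes.
\<close>

theorem theorem2:
  fixes m :: "('p, 'e, 'd) mesh" and T :: "('p, 'e) trisk" and reg :: "'p \<Rightarrow> region"
    and r :: nat and P :: fb_params and D :: "('p, 'e) stages"
    and u u' :: "'e \<Rightarrow> real" and h h' :: "'p \<Rightarrow> real"
    and \<eta> \<eta>' :: "'d \<Rightarrow> real" and \<eta>k :: "nat \<Rightarrow> 'd \<Rightarrow> real"
  assumes "valid_mesh m"
    and "lts_regions m reg"
    and "stencil_radius m T r"
    and "region_stencils m T reg"
    and "0 < dt P" and "0 < nsub P"
    and "fb_lts_step m T reg r P u h D u' h'"
    and "vorticity_step m T reg P D \<eta> \<eta>k \<eta>'"
    and "no_boundary m \<or> (\<forall>k < nsub P. no_flow m T (bu12k D k) (hsssk D k))"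
  shows "(\<Sum>v\<in>dual_cells m. dual_area m v * \<eta>' v) = (\<Sum>v\<in>dual_cells m. dual_area m v * \<eta> v)"
proof -
  let ?\<delta> = "dt P / real (nsub P)"
  have "(\<Sum>v\<in>dual_cells m. dual_area m v * \<eta>' v)
      = (\<Sum>v\<in>dual_cells m. dual_area m v * \<eta> v
          + ?\<delta> * (\<Sum>k<nsub P. dual_area m v * Theta m T (bu12k D k) (hsssk D k) v))"
    using vorticity_step_accumulated[OF assms(1,4,6,7,8)]
    by (intro sum.cong refl) (simp add: distrib_left sum_distrib_left mult_ac)
  also have "\<dots> = (\<Sum>v\<in>dual_cells m. dual_area m v * \<eta> v)
      + ?\<delta> * (\<Sum>k<nsub P. \<Sum>v\<in>dual_cells m. dual_area m v * Theta m T (bu12k D k) (hsssk D k) v)"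
    by (simp only: sum.distrib sum_distrib_left sum.swap[of _ "{..<nsub P}" "dual_cells m"])
  also have "(\<Sum>k<nsub P. \<Sum>v\<in>dual_cells m. dual_area m v * Theta m T (bu12k D k) (hsssk D k) v) = 0"
    using assms(9) by (intro sum.neutral ballI sum_area_Theta_eq_0[OF assms(1)]) auto
  finally show ?thesis
    by simp
qed

end
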